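(* Fix an integer $a\ge2$. There is a polynomial $P_a$ of degree $2$ such that for every positive integer $b$ relatively prime to $a$, the average size of an $(a,b)$-core equals $P_a(b)$.
   Context: A partition is an $a$-core if no cell of its Young diagram has hook length (arm + leg + 1) equal to $a$; an $(a,b)$-core is a partition that is both an $a$-core and a $b$-core. For $a,b$ relatively prime there are finitely many $(a,b)$-cores, and the average size is $\frac{1}{|\mathcal{C}_{a,b}|}\sum_{\lambda\in\mathcal{C}_{a,b}}|\lambda|$, where $\mathcal{C}_{a,b}$ is the set of $(a,b)$-cores and $|\lambda|$ is the size (sum of parts). *)

theory Defs
  imports Complex_Main "HOL-Computational_Algebra.Polynomial"
begin

text \<open>A partition is the list of its parts, weakly decreasing and all positive.  Rows and columns
  of the Young diagram are numbered from 0.\<close>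

definition is_partition :: "nat list \<Rightarrow> bool" where
  "is_partition xs \<longleftrightarrow> sorted_wrt (\<ge>) xs \<and> (\<forall>x\<in>set xs. 0 < x)"

definition cells :: "nat list \<Rightarrow> (nat \<times> nat) set" where
  "cells xs = {(i, j). i < length xs \<and> j < xs ! i}"

definition arm :: "nat list \<Rightarrow> nat \<times> nat \<Rightarrow> nat" where
  "arm xs c = card {j. snd c < j \<and> (fst c, j) \<in> cells xs}"

definition leg :: "nat list \<Rightarrow> nat \<times> nat \<Rightarrow> nat" where
  "leg xs c = card {i. fst c < i \<and> (i, snd c) \<in> cells xs}"

definition hook_length :: "nat list \<Rightarrow> nat \<times> nat \<Rightarrow> nat" where
  "hook_length xs c = arm xs c + leg xs c + 1"

definition is_core :: "nat \<Rightarrow> nat list \<Rightarrow> bool" where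
  "is_core a xs \<longleftrightarrow> is_partition xs \<and> (\<forall>c\<in>cells xs. hook_length xs c \<noteq> a)"

definition simultaneous_cores :: "nat \<Rightarrow> nat \<Rightarrow> nat list set" where
  "simultaneous_cores a b = {xs. is_core a xs \<and> is_core b xs}"

text \<open>This is the average only when the set of \<open>(a, b)\<close>-cores is finite, which is the case for
  positive coprime \<open>a\<close> and \<open>b\<close>.\<close>

definition average_core_size :: "nat \<Rightarrow> nat \<Rightarrow> real" where
  "average_core_size a b =
     (\<Sum>xs\<in>simultaneous_cores a b. real (sum_list xs)) / real (card (simultaneous_cores a b))"

end

theory Submission
  imports Defs "HOL-Number_Theory.Cong"
begin

text \<open>
  The beta set of a partition (its first-column hook lengths) is closed under subtracting \<open>a\<close> exactly
  for \<open>a\<close>-cores. Let \<open>u k\<close> be the least number congruent to \<open>k * b\<close> modulo \<open>a\<close> outside the beta set.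
  The partition is also a \<open>b\<close>-core iff the numbers \<open>x k = (u k + b - u (k + 1)) / a\<close> are nonnegative;
  their sum over \<open>k < a\<close> is \<open>b\<close>. So \<open>(a, b)\<close>-cores correspond to the weak compositions \<open>x\<close> of \<open>b\<close> into
  \<open>a\<close> parts for which all heights \<open>u k = k * b - a * (x 0 + ... + x (k - 1))\<close> are nonnegative
  (rational Dyck paths), and by the cycle lemma every weak composition has exactly one cyclic shift
  of this kind.

  The size of the core is half the variance of the \<open>u k\<close> minus \<open>(a^2 - 1) / 24\<close>. This is invariant
  under cyclic shifts, so the average over cores equals the average over all weak compositions, which
  only needs the second moments of a uniformly random weak composition. The result is Armstrong's
  formula \<open>(a - 1) * (b - 1) * (a + b + 1) / 24\<close>.
\<close>

section \<open>Beta sets and hook lengths\<close>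

text \<open>The first cell of the row of \<open>x\<close> has arm \<open>x - 1\<close> and leg
  \<open>length xs\<close>, hence hook length \<open>x + length xs\<close>.\<close>

fun beta_set :: "nat list \<Rightarrow> nat set" where
  "beta_set [] = {}"
| "beta_set (x # xs) = insert (x + length xs) (beta_set xs)"

definition closed_under_diff :: "nat \<Rightarrow> nat set \<Rightarrow> bool" where
  "closed_under_diff a B \<longleftrightarrow> (\<forall>h\<in>B. a \<le> h \<longrightarrow> h - a \<in> B)"

lemma is_partition_Nil [simp]: "is_partition []"
  by (simp add: is_partition_def)

lemma is_partition_Cons:
  "is_partition (x # xs) \<longleftrightarrow> 0 < x \<and> (\<forall>y\<in>set xs. y \<le> x) \<and> is_partition xs"
  by (auto simp: is_partition_def)

lemma finite_beta_set [simp]: "finite (beta_set xs)"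
  by (induction xs) auto

lemma beta_set_less:
  assumes "is_partition (x # xs)" and "h \<in> beta_set xs"
  shows "h < x + length xs"
  using assms
proof (induction xs arbitrary: x)
  case (Cons y ys)
  show ?case
  proof (cases "h = y + length ys")
    case True
    then show ?thesis using Cons.prems by (simp add: is_partition_Cons)
  next
    case False
    then have "h < y + length ys"
      using Cons.prems by (intro Cons.IH) (auto simp: is_partition_Cons)
    then show ?thesis using Cons.prems by (simp add: is_partition_Cons)
  qed
qed simp

lemma zero_notin_beta_set: "is_partition xs \<Longrightarrow> 0 \<notin> beta_set xs"
  by (induction xs) (auto simp: is_partition_Cons)

lemma card_beta_set: "is_partition xs \<Longrightarrow> card (beta_set xs) = length xs"
proof (induction xs)
  case (Cons x xs)
  then show ?case
    using beta_set_less[OF Cons.prems, of "x + length xs"] by (auto simp: is_partition_Cons card_insert_if)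
qed simp

text \<open>Each part is shifted by the number of parts below it, so the shifts add up to 0 + 1 +
  ... + (\<open>length xs\<close> - 1).\<close>

lemma sum_beta_set:
  assumes "is_partition xs"
  shows "real (\<Sum>(beta_set xs)) = real (sum_list xs) + real (length xs) * (real (length xs) - 1) / 2"
  using assms
proof (induction xs)
  case (Cons x xs)
  have "x + length xs \<notin> beta_set xs"
    using beta_set_less[OF Cons.prems] by blast
  then show ?case
    using Cons by (simp add: is_partition_Cons field_simps)
qed simp

lemma beta_set_inj:
  assumes "is_partition xs" and "is_partition ys" and "beta_set xs = beta_set ys"
  shows "xs = ys"
  using assms
proof (induction xs arbitrary: ys)
  case Nil
  then show ?case by (cases ys) auto
next
  case (Cons x xs)
  then obtain y zs where ys: "ys = y # zs"
    by (cases ys) auto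
  have "length xs = length zs"
    using card_beta_set[OF Cons.prems(1)] card_beta_set[OF Cons.prems(2)] Cons.prems(3) ys by simp
  have x: "\<And>h. h \<in> beta_set xs \<Longrightarrow> h < x + length xs"
    using beta_set_less[OF Cons.prems(1)] by blast
  have y: "\<And>h. h \<in> beta_set zs \<Longrightarrow> h < y + length zs"
    using beta_set_less[of y zs] Cons.prems(2) ys by blast
  have eq: "insert (x + length xs) (beta_set xs) = insert (y + length zs) (beta_set zs)"
    using Cons.prems(3) ys by simp
  \<comment> \<open>Both numbers are the maximum of the common beta set.\<close>
  have m: "x + length xs = y + length zs"
  proof (rule ccontr)
    assume "x + length xs \<noteq> y + length zs"
    then have "x + length xs \<in> beta_set zs" "y + length zs \<in> beta_set xs"
      by (metis eq insertE insertI1)+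
    then show False using x y less_asym by metis
  qed
  have "beta_set xs = beta_set zs"
    using eq m x y by (metis insert_ident less_irrefl_nat)
  then have "xs = zs"
    using Cons ys by (simp add: is_partition_Cons)
  then show ?case using m ys by simp
qed

text \<open>Induction on the maximum: once the smaller elements form the beta set of
  \<open>ys\<close>, the largest element \<open>m\<close> forces the first part
  \<open>m - length ys\<close>, which is at least as large as the parts of
  \<open>ys\<close>.\<close>

lemma beta_set_surj:
  assumes "finite B" and "0 \<notin> B"
  shows "\<exists>xs. is_partition xs \<and> beta_set xs = B"
  using assms
proof (induction B rule: finite_linorder_max_induct)
  case empty
  then show ?case by (intro exI[of _ "[]"]) simp
next
  case (insert m A)
  then obtain ys where ys: "is_partition ys" "beta_set ys = A" by auto
  have m: "length ys < m \<and> (\<forall>y\<in>set ys. y \<le> m - length ys)"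
  proof (cases ys)
    case Nil
    then show ?thesis using insert.prems by auto
  next
    case (Cons y zs)
    then have "y + length zs < m" "0 < y" "\<forall>z\<in>set zs. z \<le> y"
      using insert.hyps ys by (auto simp: is_partition_Cons)
    then show ?thesis using Cons by force
  qed
  then have "is_partition ((m - length ys) # ys)" "beta_set ((m - length ys) # ys) = insert m A"
    using ys by (auto simp: is_partition_Cons)
  then show ?case by blast
qed

lemma bij_betw_beta_set: "bij_betw beta_set {xs. is_partition xs} {B. finite B \<and> 0 \<notin> B}"
  unfolding bij_betw_def
proof
  show "inj_on beta_set {xs. is_partition xs}"
    using beta_set_inj by (auto intro: inj_onI)
  show "beta_set ` {xs. is_partition xs} = {B. finite B \<and> 0 \<notin> B}"
  proof
    show "{B. finite B \<and> 0 \<notin> B} \<subseteq> beta_set ` {xs. is_partition xs}"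
      using beta_set_surj by blast
  qed (auto simp: zero_notin_beta_set)
qed

section \<open>Column lengths (the conjugate partition) and hook lengths\<close>

definition column_length :: "nat list \<Rightarrow> nat \<Rightarrow> nat" where
  "column_length xs j = length (filter (\<lambda>x. j < x) xs)"

lemma column_length_le: "column_length xs j \<le> length xs"
  by (simp add: column_length_def)

lemma column_length_antimono: "i \<le> j \<Longrightarrow> column_length xs j \<le> column_length xs i"
  by (induction xs) (auto simp: column_length_def)

text \<open>The numbers \<^term>\<open>length xs - column_length xs j + j\<close> enumerate the complement of the beta
  set, and the hook length of cell \<open>(i, j)\<close> is the \<open>i\<close>-th element of the beta set minus the \<open>j\<close>-th
  element of its complement.\<close>

lemma column_index_notin_beta_set:
  assumes "is_partition xs"
  shows "length xs - column_length xs j + j \<notin> beta_set xs"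
  using assms
proof (induction xs)
  case (Cons x xs)
  show ?case
  proof (cases "j < x")
    case True
    then show ?thesis
      using Cons column_length_le[of xs j] by (auto simp: is_partition_Cons column_length_def)
  next
    case False
    then have "column_length (x # xs) j = 0"
      using Cons.prems by (auto simp: is_partition_Cons column_length_def filter_empty_conv)
    moreover have "h \<in> beta_set (x # xs) \<Longrightarrow> h \<le> x + length xs" for h
      using beta_set_less[OF Cons.prems, of h] by auto
    ultimately show ?thesis using False by fastforce
  qed
qed simp

text \<open>Equality follows from inclusion by counting: the map is strictly increasing, so it takes
  \<open>x\<close> values on \<open>{..<x}\<close>, and the \<open>length xs\<close> elements of the
  beta set leave \<open>x\<close> numbers below \<open>x + length xs\<close>.\<close>

lemma complement_beta_set:
  assumes "is_partition (x # xs)"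
  shows "(\<lambda>j. length xs - column_length xs j + j) ` {..<x} = {..<x + length xs} - beta_set xs"
proof (rule card_subset_eq)
  have p: "is_partition xs" using assms by (simp add: is_partition_Cons)
  show "(\<lambda>j. length xs - column_length xs j + j) ` {..<x} \<subseteq> {..<x + length xs} - beta_set xs"
    using column_index_notin_beta_set[OF p] by fastforce
  have "strict_mono (\<lambda>j. length xs - column_length xs j + j)"
    by (intro strict_monoI add_le_less_mono diff_le_mono2 column_length_antimono) auto
  then have "card ((\<lambda>j. length xs - column_length xs j + j) ` {..<x}) = x"
    by (metis card_image card_lessThan inj_on_subset strict_mono_imp_inj_on subset_UNIV)
  moreover have "beta_set xs \<subseteq> {..<x + length xs}"
    using beta_set_less[OF assms] by blast
  ultimately show "card ((\<lambda>j. length xs - column_length xs j + j) ` {..<x}) =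
      card ({..<x + length xs} - beta_set xs)"
    using card_beta_set[OF p] by (simp add: card_Diff_subset)
qed simp

lemma cells_Cons_0: "(0, j) \<in> cells (x # xs) \<longleftrightarrow> j < x"
  and cells_Cons_Suc: "(Suc i, j) \<in> cells (x # xs) \<longleftrightarrow> (i, j) \<in> cells xs"
  by (auto simp: cells_def)

lemma hook_length_Cons_Suc: "hook_length (x # xs) (Suc i, j) = hook_length xs (i, j)"
proof -
  have "{k. Suc i < k \<and> (k, j) \<in> cells (x # xs)} = Suc ` {k. i < k \<and> (k, j) \<in> cells xs}"
    by (auto simp: cells_Cons_Suc image_iff elim: less_natE)
  then have "leg (x # xs) (Suc i, j) = leg xs (i, j)"
    by (simp add: leg_def card_image)
  moreover have "arm (x # xs) (Suc i, j) = arm xs (i, j)"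
    by (simp add: arm_def cells_def)
  ultimately show ?thesis by (simp add: hook_length_def)
qed

lemma hook_length_Cons_0:
  assumes "j < x"
  shows "hook_length (x # xs) (0, j) = x - j + column_length xs j"
proof -
  have "{k. 0 < k \<and> (k, j) \<in> cells (x # xs)} = Suc ` {k. k < length xs \<and> j < xs ! k}"
    by (auto simp: cells_def image_iff gr0_conv_Suc)
  then have "leg (x # xs) (0, j) = column_length xs j"
    by (simp add: leg_def card_image column_length_def length_filter_conv_card)
  moreover have "{k. j < k \<and> (0, k) \<in> cells (x # xs)} = {j<..<x}"
    by (auto simp: cells_def)
  then have "arm (x # xs) (0, j) = x - j - 1"
    by (simp add: arm_def)
  ultimately show ?thesis using assms by (simp add: hook_length_def)
qed

lemma hook_lengths_first_row:
  assumes "is_partition (x # xs)"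
  shows "(\<exists>j<x. hook_length (x # xs) (0, j) = a) \<longleftrightarrow>
    0 < a \<and> a \<le> x + length xs \<and> x + length xs - a \<notin> beta_set xs"
proof -
  have "(\<exists>j<x. hook_length (x # xs) (0, j) = a) \<longleftrightarrow>
    (\<exists>j<x. x + length xs = a + (length xs - column_length xs j + j))"
  proof (intro ex_cong1 conj_cong refl)
    fix j assume "j < x"
    then show "hook_length (x # xs) (0, j) = a \<longleftrightarrow>
        x + length xs = a + (length xs - column_length xs j + j)"
      using hook_length_Cons_0[of j x xs] column_length_le[of xs j] by auto
  qed
  also have "\<dots> \<longleftrightarrow> (\<exists>m \<in> {..<x + length xs} - beta_set xs. x + length xs = a + m)"
    by (subst complement_beta_set[OF assms, symmetric]) auto
  also have "\<dots> \<longleftrightarrow> 0 < a \<and> a \<le> x + length xs \<and> x + length xs - a \<notin> beta_set xs"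
    by (auto intro!: bexI[of _ "x + length xs - a"])
  finally show ?thesis .
qed

text \<open>Induction on rows: the first row accounts for the largest element of the beta set, and
  the lower rows keep their hook lengths.\<close>

lemma hook_length_iff_beta_set:
  assumes "is_partition xs" and "0 < a"
  shows "(\<exists>c\<in>cells xs. hook_length xs c = a) \<longleftrightarrow> (\<exists>h\<in>beta_set xs. a \<le> h \<and> h - a \<notin> beta_set xs)"
  using assms
proof (induction xs)
  case Nil
  then show ?case by (simp add: cells_def)
next
  case (Cons x xs)
  have less: "\<And>h. h \<in> beta_set xs \<Longrightarrow> h < x + length xs"
    using beta_set_less[OF Cons.prems(1)] by blast
  have "(\<exists>c\<in>cells (x # xs). hook_length (x # xs) c = a) \<longleftrightarrow>
      (\<exists>j<x. hook_length (x # xs) (0, j) = a) \<or> (\<exists>c\<in>cells xs. hook_length xs c = a)"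
    (is "?L \<longleftrightarrow> ?R")
  proof
    assume ?L
    then obtain i j where "(i, j) \<in> cells (x # xs)" "hook_length (x # xs) (i, j) = a" by auto
    then show ?R
      by (cases i) (auto simp: cells_Cons_0 cells_Cons_Suc hook_length_Cons_Suc)
  next
    assume ?R
    then show ?L
    proof
      assume "\<exists>j<x. hook_length (x # xs) (0, j) = a"
      then show ?L using cells_Cons_0 by blast
    next
      assume "\<exists>c\<in>cells xs. hook_length xs c = a"
      then obtain i j where "(i, j) \<in> cells xs" "hook_length xs (i, j) = a" by auto
      then show ?L
        by (intro bexI[of _ "(Suc i, j)"]) (simp_all add: cells_Cons_Suc hook_length_Cons_Suc)
    qed
  qed
  also have "\<dots> \<longleftrightarrow> (a \<le> x + length xs \<and> x + length xs - a \<notin> beta_set xs) \<or>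
      (\<exists>h\<in>beta_set xs. a \<le> h \<and> h - a \<notin> beta_set xs)"
    using Cons by (simp add: hook_lengths_first_row is_partition_Cons)
  also have "\<dots> \<longleftrightarrow> (\<exists>h\<in>beta_set (x # xs). a \<le> h \<and> h - a \<notin> beta_set (x # xs))"
  proof -
    \<comment> \<open>Inserting the new maximum fills none of the missing differences, since
      \<open>0 < a\<close> keeps \<open>h - a\<close> strictly below it.\<close>
    have "h - a \<noteq> x + length xs" if "h \<in> beta_set (x # xs)" "a \<le> h" for h
      using that less[of h] Cons.prems(2) by auto
    then show ?thesis by auto
  qed
  finally show ?case .
qed

lemma is_core_iff_beta_set:
  assumes "0 < a"
  shows "is_core a xs \<longleftrightarrow> is_partition xs \<and> closed_under_diff a (beta_set xs)"
  using hook_length_iff_beta_set[OF _ assms, of xs]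
  by (auto simp: is_core_def closed_under_diff_def)

text \<open>The beta sets of simultaneous cores. Equivalently, the complement is cofinite, contains
  0 and is closed under adding \<open>a\<close> and \<open>b\<close>.\<close>

definition closed_sets :: "nat \<Rightarrow> nat \<Rightarrow> nat set set" where
  "closed_sets a b = {B. finite B \<and> 0 \<notin> B \<and> closed_under_diff a B \<and> closed_under_diff b B}"

lemma bij_betw_simultaneous_cores:
  assumes "0 < a" and "0 < b"
  shows "bij_betw beta_set (simultaneous_cores a b) (closed_sets a b)"
proof -
  have c: "simultaneous_cores a b =
      {xs \<in> {xs. is_partition xs}. closed_under_diff a (beta_set xs) \<and> closed_under_diff b (beta_set xs)}"
    using assms by (auto simp: simultaneous_cores_def is_core_iff_beta_set)
  have "beta_set ` simultaneous_cores a b =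
     {B \<in> beta_set ` {xs. is_partition xs}. closed_under_diff a B \<and> closed_under_diff b B}"
    unfolding c by auto
  also have "\<dots> = closed_sets a b"
    using bij_betw_beta_set by (auto simp: bij_betw_def closed_sets_def)
  finally show ?thesis
    using bij_betw_beta_set unfolding bij_betw_def c by (auto intro: inj_on_subset)
qed

section \<open>Simultaneous cores and rational Dyck paths\<close>

text \<open>An abacus with \<open>a\<close> runners: when the \<open>w k\<close> have distinct
  residues, \<open>w k\<close> is the first empty position of its runner and all positions below it
  are filled.\<close>

definition gaps :: "nat \<Rightarrow> (nat \<Rightarrow> nat) \<Rightarrow> nat set" where
  "gaps a w = {h. \<exists>k<a. h < w k \<and> h mod a = w k mod a}"

lemma gaps_eq_UN:
  assumes "0 < a"
  shows "gaps a w = (\<Union>k<a. (\<lambda>t. w k mod a + t * a) ` {..<w k div a})"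
proof -
  have "h < w k \<and> h mod a = w k mod a \<longleftrightarrow> h \<in> (\<lambda>t. w k mod a + t * a) ` {..<w k div a}" for h k
  proof
    assume h: "h < w k \<and> h mod a = w k mod a"
    then have "h = w k mod a + (h div a) * a"
      by (metis mod_div_mult_eq)
    moreover have "h div a < w k div a"
    proof (rule ccontr)
      assume "\<not> h div a < w k div a"
      then have "w k div a * a \<le> h div a * a" by simp
      then show False using h mod_div_mult_eq[of h a] mod_div_mult_eq[of "w k" a] by linarith
    qed
    ultimately show "h \<in> (\<lambda>t. w k mod a + t * a) ` {..<w k div a}" by blast
  next
    assume "h \<in> (\<lambda>t. w k mod a + t * a) ` {..<w k div a}"
    then obtain t where t: "t < w k div a" "h = w k mod a + t * a" by auto
    have "t * a < (w k div a) * a" using t assms by simp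
    then have "h < w k" using t(2) mod_div_mult_eq[of "w k" a] by linarith
    then show "h < w k \<and> h mod a = w k mod a" using t by simp
  qed
  then show ?thesis by (auto simp: gaps_def)
qed

lemma finite_gaps [simp]: "0 < a \<Longrightarrow> finite (gaps a w)"
  by (simp add: gaps_eq_UN)

text \<open>Distinct residues make the classes disjoint, and below \<open>w k\<close> its class is
  an arithmetic progression of \<open>w k div a\<close> terms.\<close>

lemma sum_gaps:
  assumes "0 < a" and "inj_on (\<lambda>k. w k mod a) {..<a}"
  shows "(\<Sum>h\<in>gaps a w. g h) = (\<Sum>k<a. \<Sum>t<w k div a. g (w k mod a + t * a))"
proof -
  have disj: "(\<lambda>t. w k mod a + t * a) ` {..<w k div a} \<inter> (\<lambda>t. w l mod a + t * a) ` {..<w l div a} = {}"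
    if "k < a" "l < a" "k \<noteq> l" for k l
  proof -
    have "w k mod a \<noteq> w l mod a" using inj_on_eq_iff[OF assms(2), of k l] that by simp
    then have "w k mod a + t * a \<noteq> w l mod a + s * a" for s t
      by (metis mod_mod_trivial mod_mult_self1)
    then show ?thesis by auto
  qed
  have "(\<Sum>h\<in>gaps a w. g h) = (\<Sum>k<a. \<Sum>h\<in>(\<lambda>t. w k mod a + t * a) ` {..<w k div a}. g h)"
    unfolding gaps_eq_UN[OF assms(1)] using disj by (subst sum.UNION_disjoint) auto
  also have "\<dots> = (\<Sum>k<a. \<Sum>t<w k div a. g (w k mod a + t * a))"
  proof (rule sum.cong[OF refl])
    fix k
    have "inj_on (\<lambda>t. w k mod a + t * a) {..<w k div a}" using assms(1) by (simp add: inj_on_def)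
    then show "(\<Sum>h\<in>(\<lambda>t. w k mod a + t * a) ` {..<w k div a}. g h) =
        (\<Sum>t<w k div a. g (w k mod a + t * a))"
      by (simp add: sum.reindex)
  qed
  finally show ?thesis .
qed

text \<open>The residues of \<open>a\<close> numbers in distinct classes are a permutation of 0,
  ..., \<open>a - 1\<close>, so their power sums do not depend on \<open>w\<close>.\<close>

lemma sum_residues:
  assumes "inj_on (\<lambda>k. w k mod a) {..<a::nat}"
  shows "(\<Sum>k<a. g (w k mod a)) = (\<Sum>i<a. g i)"
proof -
  have "(\<lambda>k. w k mod a) ` {..<a} = {..<a}"
    by (rule endo_inj_surj[OF _ _ assms]) auto
  then show ?thesis
    using sum.reindex[OF assms, of g] by (simp add: o_def)
qed

section \<open>Power sums and the size of a core as a variance\<close>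

lemma sum_real_lessThan: "(\<Sum>i<n. real i) = real n * (real n - 1) / 2"
  by (induction n) (auto simp: field_simps)

lemma sum_real_squares_lessThan:
  "(\<Sum>i<n. (real i)\<^sup>2) = real n * (real n - 1) * (2 * real n - 1) / 6"
  by (induction n) (auto simp: field_simps power2_eq_square)

text \<open>Both sides are \<open>2 * n^2\<close> times the variance of the
  \<open>u k\<close>.\<close>

lemma sum_squared_differences:
  "(\<Sum>k<n. \<Sum>l<n. (u k - u l)\<^sup>2) = 2 * real n * (\<Sum>k<n. (u k)\<^sup>2) - 2 * (\<Sum>k<n. u k :: real)\<^sup>2"
proof -
  have "(\<Sum>k<n. \<Sum>l<n. (u k - u l)\<^sup>2) =
      (\<Sum>k<n. \<Sum>l<n. (u k)\<^sup>2) + (\<Sum>k<n. \<Sum>l<n. (u l)\<^sup>2) - 2 * (\<Sum>k<n. \<Sum>l<n. u k * u l)"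
    by (simp add: power2_diff sum.distrib sum_subtractf sum_distrib_left mult.assoc)
  also have "(\<Sum>k<n. \<Sum>l<n. u k * u l) = (\<Sum>k<n. u k)\<^sup>2"
    by (simp add: power2_eq_square sum_product)
  finally show ?thesis by (simp add: sum_distrib_left mult.assoc)
qed

text \<open>The size of an \<open>a\<close>-core is half the variance of the numbers \<open>w k\<close>, up to a constant. In
  particular it only depends on their differences.\<close>

lemma size_gaps:
  assumes "0 < a" and inj: "inj_on (\<lambda>k. w k mod a) {..<a}"
  shows "real (\<Sum>(gaps a w)) - real (card (gaps a w)) * (real (card (gaps a w)) - 1) / 2 =
    (\<Sum>k<a. \<Sum>l<a. (real (w k) - real (w l))\<^sup>2) / (4 * (real a)\<^sup>2) - ((real a)\<^sup>2 - 1) / 24"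
proof -
  define S where "S = (\<Sum>k<a. real (w k))"
  define T where "T = (\<Sum>k<a. (real (w k))\<^sup>2)"
  have R1: "(\<Sum>k<a. real (w k mod a)) = real a * (real a - 1) / 2"
    using sum_residues[OF inj, of real] by (simp add: sum_real_lessThan)
  have R2: "(\<Sum>k<a. (real (w k mod a))\<^sup>2) = real a * (real a - 1) * (2 * real a - 1) / 6"
    using sum_residues[OF inj, of "\<lambda>i. (real i)\<^sup>2"] by (simp add: sum_real_squares_lessThan)
  have w: "real (w k div a) = (real (w k) - real (w k mod a)) / real a" for k
  proof -
    have "real (w k) = real (w k mod a + w k div a * a)" by (simp only: mod_div_mult_eq)
    then have "real (w k) = real (w k mod a) + real (w k div a) * real a"
      by (simp only: of_nat_add of_nat_mult)
    then show ?thesis using assms(1) by (simp add: eq_divide_eq)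
  qed
  have "real (card (gaps a w)) = (\<Sum>k<a. (real (w k) - real (w k mod a)) / real a)"
    using sum_gaps[OF assms, of "\<lambda>_. 1::real"] by (simp add: w)
  also have "\<dots> = (S - real a * (real a - 1) / 2) / real a"
    by (simp add: sum_divide_distrib[symmetric] sum_subtractf R1 S_def)
  finally have card: "real (card (gaps a w)) = (S - real a * (real a - 1) / 2) / real a" .
  have "(\<Sum>t<w k div a. real (w k mod a + t * a)) =
      ((real (w k))\<^sup>2 - (real (w k mod a))\<^sup>2 - real a * (real (w k) - real (w k mod a))) / (2 * real a)" for k
  proof -
    have "(\<Sum>t<w k div a. real (w k mod a + t * a)) = real (w k div a) * real (w k mod a)
        + real a * (real (w k div a) * (real (w k div a) - 1) / 2)"
      by (simp add: sum.distrib sum_distrib_right[symmetric] sum_real_lessThan)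
    also have "\<dots> = ((real (w k))\<^sup>2 - (real (w k mod a))\<^sup>2
        - real a * (real (w k) - real (w k mod a))) / (2 * real a)"
      unfolding w using assms(1) by (simp add: field_simps power2_eq_square)
    finally show ?thesis .
  qed
  then have "real (\<Sum>(gaps a w)) = (\<Sum>k<a. ((real (w k))\<^sup>2 - (real (w k mod a))\<^sup>2
      - real a * (real (w k) - real (w k mod a))) / (2 * real a))"
    using sum_gaps[OF assms, of real] by simp
  also have "\<dots> = (T - real a * (real a - 1) * (2 * real a - 1) / 6
      - real a * (S - real a * (real a - 1) / 2)) / (2 * real a)"
    by (simp add: sum_divide_distrib[symmetric] sum_subtractf sum_distrib_left[symmetric] R1 R2
        S_def T_def)
  finally have total: "real (\<Sum>(gaps a w)) = (T - real a * (real a - 1) * (2 * real a - 1) / 6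
      - real a * (S - real a * (real a - 1) / 2)) / (2 * real a)" .
  \<comment> \<open>The terms linear in \<open>S\<close> cancel; what remains is
    \<open>T / (2 * a) - S^2 / (2 * a^2)\<close> and a constant.\<close>
  show ?thesis
    unfolding total card sum_squared_differences S_def[symmetric] T_def[symmetric]
    using assms(1) by (simp add: field_simps power2_eq_square)
qed

section \<open>Weak compositions, heights and rational Dyck paths\<close>

definition compositions :: "nat \<Rightarrow> nat \<Rightarrow> (nat \<Rightarrow> nat) set" where
  "compositions a b = {f. (\<forall>k\<ge>a. f k = 0) \<and> (\<Sum>k<a. f k) = b}"

text \<open>Reducing the index modulo \<open>a\<close> extends the path past \<open>a\<close>; for
  compositions of \<open>b\<close> it becomes periodic, which is what cyclic shifts use.\<close>

definition height :: "nat \<Rightarrow> nat \<Rightarrow> (nat \<Rightarrow> nat) \<Rightarrow> nat \<Rightarrow> int" where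
  "height a b f k = int k * int b - int a * (\<Sum>j<k. int (f (j mod a)))"

definition dyck :: "nat \<Rightarrow> nat \<Rightarrow> (nat \<Rightarrow> nat) set" where
  "dyck a b = {f \<in> compositions a b. \<forall>k<a. 0 \<le> height a b f k}"

lemma height_0 [simp]: "height a b f 0 = 0"
  by (simp add: height_def)

lemma height_Suc: "height a b f (Suc k) = height a b f k + int b - int a * int (f (k mod a))"
  by (simp add: height_def algebra_simps)

lemma height_period:
  assumes "f \<in> compositions a b"
  shows "height a b f a = 0"
proof -
  have "(\<Sum>j<a. int (f (j mod a))) = (\<Sum>j<a. int (f j))" by (intro sum.cong) auto
  also have "\<dots> = int b"
    using assms unfolding compositions_def by (simp flip: of_nat_sum)
  finally show ?thesis by (simp add: height_def)
qed

text \<open>Every step changes the height by \<open>b\<close> modulo \<open>a\<close>, whatever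
  \<open>f\<close> is.\<close>

lemma height_mod: "height a b f k mod int a = int (k * b) mod int a"
proof -
  have "[height a b f k = int k * int b] (mod int a)"
    by (simp add: height_def cong_iff_dvd_diff)
  then show ?thesis by (simp add: cong_def)
qed

lemma mult_mod_inj:
  assumes "coprime a b" and "k < a" and "l < a" and "k * b mod a = l * b mod (a::nat)"
  shows "k = l"
proof -
  have "[k * b = l * b] (mod a)" using assms(4) by (simp add: cong_def)
  then have "[k = l] (mod a)"
    using assms(1) by (simp add: cong_mult_rcancel_nat coprime_commute)
  then show ?thesis
    using assms(2,3) by (simp add: cong_less_modulus_unique_nat)
qed

lemma height_mod_inj:
  assumes "coprime a b" and "k < a" and "l < a"
    and "height a b f k mod int a = height a b g l mod int a"
  shows "k = l"
proof (rule mult_mod_inj[OF assms(1-3)])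
  have "int (k * b mod a) = int (l * b mod a)"
    using assms(4) unfolding height_mod zmod_int .
  then show "k * b mod a = l * b mod a" by (simp only: of_nat_eq_iff)
qed

lemma nat_height_mod:
  assumes "f \<in> dyck a b" and "k < a"
  shows "nat (height a b f k) mod a = k * b mod a"
proof -
  have "int (nat (height a b f k) mod a) = height a b f k mod int a"
    using assms by (simp add: dyck_def zmod_int)
  then have "int (nat (height a b f k) mod a) = int (k * b mod a)"
    unfolding height_mod zmod_int .
  then show ?thesis by (simp only: of_nat_eq_iff)
qed

text \<open>A step raises the height by at most \<open>b\<close>, which gives closure under
  subtracting \<open>b\<close>. The number 0 is missing because only index 0 has residue 0, and its
  height is 0.\<close>

lemma gaps_in_closed_sets:
  assumes "0 < a" and "coprime a b" and f: "f \<in> dyck a b"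
  shows "gaps a (\<lambda>k. nat (height a b f k)) \<in> closed_sets a b"
proof -
  let ?w = "\<lambda>k. nat (height a b f k)"
  have "0 \<notin> gaps a ?w"
  proof
    assume "0 \<in> gaps a ?w"
    then obtain k where k: "k < a" "0 < ?w k" "?w k mod a = 0" by (auto simp: gaps_def)
    then have "k * b mod a = 0 * b mod a" using nat_height_mod[OF f, of k] by simp
    then have "k = 0" using mult_mod_inj[OF assms(2) k(1) assms(1)] by blast
    then show False using k by simp
  qed
  moreover have "closed_under_diff a (gaps a ?w)"
    unfolding closed_under_diff_def gaps_def
    by (auto simp: le_mod_geq intro: order.strict_trans1[OF diff_le_self])
  moreover have "closed_under_diff b (gaps a ?w)"
    unfolding closed_under_diff_def
  proof (intro ballI impI)
    fix h assume "h \<in> gaps a ?w" and bh: "b \<le> h"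
    then obtain k where k: "k < a" "h < ?w k" "h mod a = ?w k mod a" by (auto simp: gaps_def)
    \<comment> \<open>The case \<open>k = 0\<close> is impossible: no \<open>h\<close> lies below
      height 0.\<close>
    then obtain l where l: "k = Suc l" by (cases k) auto
    have "height a b f k \<le> height a b f l + int b" using k l by (simp add: height_Suc)
    then have "int (h - b) < height a b f l" using k(2) bh by (simp add: of_nat_diff)
    then have "h - b < ?w l" by simp
    moreover have "(h - b) mod a = ?w l mod a"
    proof -
      have "[h = Suc l * b] (mod a)" using k l nat_height_mod[OF f, of k] by (simp add: cong_def)
      then have "[(h - b) + b = l * b + b] (mod a)" using bh by (simp add: add.commute)
      then have "[h - b = l * b] (mod a)" by (simp only: cong_add_rcancel_nat)
      then show ?thesis using k l nat_height_mod[OF f, of l] by (simp add: cong_def)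
    qed
    ultimately show "h - b \<in> gaps a ?w" 
      using k(1) l unfolding gaps_def by (intro CollectI exI[of _ l]) simp
  qed
  ultimately show ?thesis using assms(1) by (simp add: closed_sets_def)
qed

text \<open>Otherwise the height of \<open>f\<close> at \<open>k\<close> would belong to the set of
  \<open>g\<close>, hence to that of \<open>f\<close>, which misses it by construction.\<close>

lemma height_le_if_gaps_subset:
  assumes "coprime a b" and f: "f \<in> dyck a b" and g: "g \<in> dyck a b"
    and "gaps a (\<lambda>k. nat (height a b g k)) \<subseteq> gaps a (\<lambda>k. nat (height a b f k))" and "k < a"
  shows "height a b g k \<le> height a b f k"
proof (rule ccontr)
  let ?h = "nat (height a b f k)"
  assume "\<not> height a b g k \<le> height a b f k"
  moreover have "0 \<le> height a b f k" using f assms(5) by (simp add: dyck_def)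
  ultimately have "?h \<in> gaps a (\<lambda>k. nat (height a b g k))"
    using assms(5) nat_height_mod[OF f assms(5)] nat_height_mod[OF g assms(5)] by (auto simp: gaps_def)
  then obtain l where "l < a" "?h < nat (height a b f l)" "?h mod a = nat (height a b f l) mod a"
    using assms(4) unfolding gaps_def by blast
  moreover from this have "l * b mod a = k * b mod a"
    using nat_height_mod[OF f, of l] nat_height_mod[OF f assms(5)] by simp
  then have "l = k" using mult_mod_inj[OF assms(1) \<open>l < a\<close> assms(5)] by blast
  ultimately show False by simp
qed

text \<open>The set determines the heights, and successive heights determine the values of the
  composition.\<close>

lemma gaps_inj_on:
  assumes "0 < a" and "coprime a b"
  shows "inj_on (\<lambda>f. gaps a (\<lambda>k. nat (height a b f k))) (dyck a b)"
proof (rule inj_onI)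
  fix f g
  assume f: "f \<in> dyck a b" and g: "g \<in> dyck a b"
    and eq: "gaps a (\<lambda>k. nat (height a b f k)) = gaps a (\<lambda>k. nat (height a b g k))"
  have fc: "f \<in> compositions a b" and gc: "g \<in> compositions a b"
    using f g by (auto simp: dyck_def)
  have less: "height a b f k = height a b g k" if "k < a" for k
    using height_le_if_gaps_subset[OF assms(2)] f g eq that by (intro antisym) auto
  \<comment> \<open>The value at \<open>a - 1\<close> also requires the height at \<open>a\<close>,
    which is 0 for both.\<close>
  have le: "height a b f k = height a b g k" if "k \<le> a" for k
    using that less[of k] height_period[OF fc] height_period[OF gc] by (cases "k = a") auto
  show "f = g"
  proof
    fix k
    show "f k = g k"
    proof (cases "k < a")
      case True
      then have "int a * int (f k) = int a * int (g k)"
        using le[of k] le[of "Suc k"] by (simp add: height_Suc)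
      then show ?thesis using assms(1) by simp
    next
      case False
      then show ?thesis using fc gc by (simp add: compositions_def)
    qed
  qed
qed

text \<open>The least non-elements \<open>w k\<close> of the residue classes are the required
  heights, and their differences define the composition.\<close>

lemma gaps_surj:
  assumes a: "0 < a" and "coprime a b" and B: "B \<in> closed_sets a b"
  shows "\<exists>f\<in>dyck a b. gaps a (\<lambda>k. nat (height a b f k)) = B"
proof -
  define w where "w k = (LEAST m. m \<notin> B \<and> m mod a = k * b mod a)" for k
  have fin: "finite B" and zero: "0 \<notin> B" and ca: "closed_under_diff a B" and cb: "closed_under_diff b B"
    using B by (auto simp: closed_sets_def)
  have ex: "\<exists>m. m \<notin> B \<and> m mod a = k * b mod a" for k
  proof -
    obtain n where n: "\<And>x. x \<in> B \<Longrightarrow> x < n"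
      using fin by (auto simp: finite_nat_set_iff_bounded)
    have "n \<le> n * a" using a by simp
    then have "k * b + n * a \<notin> B" using n[of "k * b + n * a"] by linarith
    then show ?thesis by (intro exI[of _ "k * b + n * a"]) simp
  qed
  have w: "w k \<notin> B" "w k mod a = k * b mod a" for k
    using LeastI_ex[OF ex[of k]] by (auto simp: w_def)
  have sub: "m - t * a \<in> B" if "m \<in> B" "t * a \<le> m" for m t
    using that
  proof (induction t)
    case (Suc t)
    then have "m - t * a \<in> B" "a \<le> m - t * a" by auto
    then have "m - t * a - a \<in> B" using ca unfolding closed_under_diff_def by blast
    then show ?case by (simp add: diff_diff_left add.commute)
  qed simp
  have iff: "m \<in> B \<longleftrightarrow> m < w k" if "m mod a = k * b mod a" for m k
  proof
    assume "m < w k"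
    then show "m \<in> B" using not_less_Least that unfolding w_def by blast
  next
    assume m: "m \<in> B"
    show "m < w k"
    proof (rule ccontr)
      assume "\<not> m < w k"
      then have le: "w k \<le> m" by simp
      have "a dvd m - w k"
        using mod_eq_dvd_iff_nat[OF le, of a] that w(2)[of k] by simp
      then obtain t where "m - w k = t * a" by (metis dvd_div_mult_self)
      then have "w k = m - t * a" "t * a \<le> m" using le by auto
      then show False using sub[OF m] w(1) by metis
    qed
  qed
  have w0: "w 0 = 0" using iff[of 0 0] zero by simp
  have wa: "w a = 0" using iff[of 0 a] zero by simp
  \<comment> \<open>Closure under subtracting \<open>b\<close> keeps \<open>w k + b\<close> outside
    \<open>B\<close>, and it lies in the class of \<open>w (Suc k)\<close>.\<close>
  have step: "w (Suc k) \<le> w k + b" for k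
  proof -
    have m: "(w k + b) mod a = Suc k * b mod a"
      by (metis w(2) mod_add_left_eq mult_Suc add.commute)
    have "w k + b \<notin> B"
      using w(1)[of k] cb by (force simp: closed_under_diff_def)
    then show ?thesis using iff[OF m] by simp
  qed
  have dvd: "a dvd w k + b - w (Suc k)" for k
  proof -
    have "(w k + b) mod a = w (Suc k) mod a"
      by (metis w(2) mod_add_left_eq mult_Suc add.commute)
    then show ?thesis using mod_eq_dvd_iff_nat[OF step, of k a] by simp
  qed
  \<comment> \<open>This solves the recursion of \<open>height_Suc\<close> for the heights
    \<open>w\<close>; by \<open>step\<close> and \<open>dvd\<close> the subtraction and division are
    exact.\<close>
  define f where "f k = (if k < a then (w k + b - w (Suc k)) div a else 0)" for k
  have f: "int a * int (f k) = int (w k) + int b - int (w (Suc k))" if "k < a" for k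
  proof -
    have "a * f k = w k + b - w (Suc k)" using that dvd[of k] by (simp add: f_def)
    then have "int (a * f k) = int (w k + b - w (Suc k))" by simp
    then show ?thesis using step[of k] by (simp add: of_nat_diff)
  qed
  have h: "height a b f k = int (w k)" if "k \<le> a" for k
    using that
  proof (induction k)
    case (Suc k)
    then show ?case using f[of k] by (simp add: height_Suc)
  qed (simp add: w0)
  have "int b = (\<Sum>j<a. int (f j))"
    using h[of a] wa a by (simp add: height_def)
  then have "(\<Sum>j<a. f j) = b" by (simp flip: of_nat_sum)
  then have "f \<in> dyck a b"
    using h by (auto simp: dyck_def compositions_def f_def)
  moreover have "gaps a (\<lambda>k. nat (height a b f k)) = B"
  proof -
    have "gaps a (\<lambda>k. nat (height a b f k)) = {m. \<exists>k<a. m < w k \<and> m mod a = k * b mod a}"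
      using h w(2) by (auto simp: gaps_def)
    also have "\<dots> = {m \<in> B. \<exists>k<a. m mod a = k * b mod a}"
      using iff by blast
    also have "\<dots> = B"
    proof -
      have "\<exists>k<a. m mod a = k * b mod a" for m
      proof -
        have "inj_on (\<lambda>k. k * b mod a) {..<a}"
          using mult_mod_inj[OF assms(2)] by (auto intro: inj_onI)
        then have "(\<lambda>k. k * b mod a) ` {..<a} = {..<a}"
          using a by (intro endo_inj_surj) auto
        moreover have "m mod a \<in> {..<a}" using a by simp
        ultimately show ?thesis by (auto simp: image_iff set_eq_iff)
      qed
      then show ?thesis by blast
    qed
    finally show ?thesis .
  qed
  ultimately show ?thesis by blast
qed

lemma bij_betw_dyck_closed_sets:
  assumes "0 < a" and "coprime a b"
  shows "bij_betw (\<lambda>f. gaps a (\<lambda>k. nat (height a b f k))) (dyck a b) (closed_sets a b)"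
  unfolding bij_betw_def
  using gaps_inj_on[OF assms] gaps_in_closed_sets[OF assms] gaps_surj[OF assms] by blast

text \<open>By \<open>size_gaps\<close> this is the only part of the core size that varies with
  \<open>f\<close>.\<close>

definition spread :: "nat \<Rightarrow> nat \<Rightarrow> (nat \<Rightarrow> nat) \<Rightarrow> real" where
  "spread a b f = (\<Sum>k<a. \<Sum>l<a. (real_of_int (height a b f k) - real_of_int (height a b f l))\<^sup>2)"

text \<open>The two bijections carry the sum from cores to Dyck paths; \<open>size_gaps\<close>
  applies because the heights are nonnegative with distinct residues.\<close>

lemma average_core_size_dyck:
  assumes "0 < a" and "0 < b" and "coprime a b"
  shows "average_core_size a b =
    (\<Sum>f\<in>dyck a b. spread a b f / (4 * (real a)\<^sup>2) - ((real a)\<^sup>2 - 1) / 24) / real (card (dyck a b))"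
proof -
  let ?size = "\<lambda>B. real (\<Sum>B) - real (card B) * (real (card B) - 1) / 2"
  note b1 = bij_betw_simultaneous_cores[OF assms(1,2)]
  note b2 = bij_betw_dyck_closed_sets[OF assms(1,3)]
  have "(\<Sum>xs\<in>simultaneous_cores a b. real (sum_list xs)) =
      (\<Sum>xs\<in>simultaneous_cores a b. ?size (beta_set xs))"
    by (intro sum.cong refl)
      (simp add: simultaneous_cores_def is_core_def sum_beta_set card_beta_set del: of_nat_sum)
  also have "\<dots> = (\<Sum>B\<in>closed_sets a b. ?size B)"
    by (rule sum.reindex_bij_betw[OF b1])
  also have "\<dots> = (\<Sum>f\<in>dyck a b. ?size (gaps a (\<lambda>k. nat (height a b f k))))"
    by (rule sum.reindex_bij_betw[OF b2, symmetric])
  also have "\<dots> = (\<Sum>f\<in>dyck a b. spread a b f / (4 * (real a)\<^sup>2) - ((real a)\<^sup>2 - 1) / 24)"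
  proof (intro sum.cong refl)
    fix f assume f: "f \<in> dyck a b"
    have "inj_on (\<lambda>k. nat (height a b f k) mod a) {..<a}"
    proof (rule inj_onI)
      fix k l assume "k \<in> {..<a}" "l \<in> {..<a}"
        and "nat (height a b f k) mod a = nat (height a b f l) mod a"
      then show "k = l"
        using nat_height_mod[OF f] mult_mod_inj[OF assms(3), of k l] by simp
    qed
    moreover have "real (nat (height a b f k)) = real_of_int (height a b f k)" if "k < a" for k
      using f that by (simp add: dyck_def)
    ultimately show "?size (gaps a (\<lambda>k. nat (height a b f k))) =
        spread a b f / (4 * (real a)\<^sup>2) - ((real a)\<^sup>2 - 1) / 24"
      by (subst size_gaps[OF assms(1)]) (auto simp: spread_def)
  qed
  finally show ?thesis
    using bij_betw_same_card[OF b1] bij_betw_same_card[OF b2] by (simp add: average_core_size_def)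
qed

section \<open>Cyclic shifts\<close>

definition cyclic_shift :: "nat \<Rightarrow> nat \<Rightarrow> (nat \<Rightarrow> nat) \<Rightarrow> nat \<Rightarrow> nat" where
  "cyclic_shift a m f k = (if k < a then f ((k + m) mod a) else 0)"

lemma add_mod_inj_on: "inj_on (\<lambda>k. (k + m) mod a) {..<a::nat}"
proof (rule inj_onI)
  fix k l assume kl: "k \<in> {..<a}" "l \<in> {..<a}" and "(k + m) mod a = (l + m) mod a"
  then have "[k + m = l + m] (mod a)" by (simp add: cong_def)
  then have "[k = l] (mod a)" by (simp only: cong_add_rcancel_nat)
  then show "k = l" using kl by (simp add: cong_less_modulus_unique_nat)
qed

lemma add_mod_image: "(\<lambda>k. (k + m) mod a) ` {..<a} = {..<a::nat}"
  by (rule endo_inj_surj[OF _ _ add_mod_inj_on]) auto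

lemma sum_add_mod: "(\<Sum>k<a. g ((k + m) mod a)) = (\<Sum>k<a. g (k::nat))"
  using sum.reindex[OF add_mod_inj_on, of g m a] by (simp add: add_mod_image o_def)

section \<open>Weak compositions under cyclic shifts\<close>

lemma finite_compositions: "finite (compositions a b)"
proof (rule finite_subset)
  show "finite {f. (\<forall>k. (k \<in> {..<a} \<longrightarrow> f k \<in> {..b}) \<and> (k \<notin> {..<a} \<longrightarrow> f k = 0))}"
    by (rule finite_set_of_finite_funs) auto
  have "f k \<le> b" if "f \<in> compositions a b" "k < a" for f k
    using that member_le_sum[of k "{..<a}" f] by (auto simp: compositions_def)
  then show "compositions a b \<subseteq> {f. (\<forall>k. (k \<in> {..<a} \<longrightarrow> f k \<in> {..b}) \<and> (k \<notin> {..<a} \<longrightarrow> f k = 0))}"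
    by (auto simp: compositions_def)
qed

lemma card_compositions_pos:
  assumes "0 < a"
  shows "0 < card (compositions a b)"
proof -
  have "(\<lambda>k. if k = 0 then b else 0) \<in> compositions a b"
    using assms by (auto simp: compositions_def sum.delta)
  then show ?thesis using finite_compositions by (auto simp: card_gt_0_iff)
qed

lemma cyclic_shift_in_compositions:
  "f \<in> compositions a b \<Longrightarrow> cyclic_shift a m f \<in> compositions a b"
  using sum_add_mod[of f m a] by (simp add: compositions_def cyclic_shift_def)

lemma bij_betw_cyclic_shift: "bij_betw (cyclic_shift a m) (compositions a b) (compositions a b)"
proof -
  have "inj_on (cyclic_shift a m) (compositions a b)"
  proof (rule inj_onI, rule ext)
    fix f g k
    assume f: "f \<in> compositions a b" and g: "g \<in> compositions a b"
      and eq: "cyclic_shift a m f = cyclic_shift a m g"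
    show "f k = g k"
    proof (cases "k < a")
      case True
      then obtain j where j: "j < a" "k = (j + m) mod a"
        using add_mod_image[of m a] by blast
      then show ?thesis
        using fun_cong[OF eq, of j] by (simp add: cyclic_shift_def)
    next
      case False
      then show ?thesis using f g by (simp add: compositions_def)
    qed
  qed
  moreover have "cyclic_shift a m ` compositions a b \<subseteq> compositions a b"
    using cyclic_shift_in_compositions by blast
  ultimately show ?thesis
    using endo_inj_surj[OF finite_compositions] unfolding bij_betw_def by blast
qed

section \<open>The cycle lemma and sums over Dyck paths\<close>

lemma height_cyclic_shift:
  assumes "0 < a"
  shows "height a b (cyclic_shift a m f) k = height a b f (k + m) - height a b f m"
proof (induction k)
  case (Suc k)
  have "cyclic_shift a m f (k mod a) = f ((k + m) mod a)"
    using assms by (simp add: cyclic_shift_def mod_add_left_eq)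
  then show ?case using Suc by (simp add: height_Suc)
qed simp

lemma height_mod_period:
  assumes "f \<in> compositions a b" and "0 < a"
  shows "height a b f (k mod a) = height a b f k"
proof (induction k)
  case (Suc k)
  show ?case
  proof (cases "Suc (k mod a) = a")
    case True
    then have "height a b f (Suc (k mod a)) = 0" and "Suc k mod a = 0"
      using height_period[OF assms(1)] by (simp_all add: mod_Suc)
    then show ?thesis using Suc by (simp add: height_Suc)
  next
    case False
    then show ?thesis using Suc by (simp add: mod_Suc height_Suc)
  qed
qed simp

text \<open>The cycle lemma: a cyclic shift is a Dyck path iff it starts at the minimal height, and the
  heights over one period are distinct because they are distinct modulo \<open>a\<close>.\<close>

lemma cyclic_shift_in_dyck_iff:
  assumes f: "f \<in> compositions a b" and "0 < a"
  shows "cyclic_shift a m f \<in> dyck a b \<longleftrightarrow> (\<forall>k<a. height a b f m \<le> height a b f k)"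
proof -
  have "cyclic_shift a m f \<in> dyck a b \<longleftrightarrow> (\<forall>k\<in>{..<a}. height a b f m \<le> height a b f ((k + m) mod a))"
    using cyclic_shift_in_compositions[OF f]
    by (auto simp: dyck_def height_cyclic_shift[OF assms(2)] height_mod_period[OF assms])
  also have "\<dots> \<longleftrightarrow> (\<forall>k\<in>(\<lambda>k. (k + m) mod a) ` {..<a}. height a b f m \<le> height a b f k)"
    by blast
  finally show ?thesis by (simp add: add_mod_image Ball_def)
qed

lemma cycle_lemma:
  assumes f: "f \<in> compositions a b" and "0 < a" and "coprime a b"
  shows "\<exists>!m. m < a \<and> cyclic_shift a m f \<in> dyck a b"
proof -
  have "\<exists>m. m \<in> {..<a} \<and> (\<forall>k\<in>{..<a}. height a b f m \<le> height a b f k)"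
    using ex_is_arg_min_if_finite[of "{..<a}" "height a b f"] assms(2)
    by (auto simp: is_arg_min_linorder)
  then obtain m where m: "m < a" "\<And>k. k < a \<Longrightarrow> height a b f m \<le> height a b f k" by auto
  show ?thesis
  proof (rule ex1I[of _ m])
    show "m < a \<and> cyclic_shift a m f \<in> dyck a b"
      using m cyclic_shift_in_dyck_iff[OF assms(1,2)] by blast
  next
    fix l assume l: "l < a \<and> cyclic_shift a l f \<in> dyck a b"
    then have "height a b f l = height a b f m"
      using m cyclic_shift_in_dyck_iff[OF assms(1,2)] by (meson order_antisym)
    then show "l = m"
      using height_mod_inj[OF assms(3), of l m f f] l m(1) by simp
  qed
qed

text \<open>Each composition is counted through its unique shift that is a Dyck path. After
  exchanging the sums, each of the \<open>a\<close> shifts permutes the compositions and so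
  contributes one full sum over Dyck paths.\<close>

lemma sum_compositions_eq_sum_dyck:
  fixes q :: "(nat \<Rightarrow> nat) \<Rightarrow> real"
  assumes "0 < a" and "coprime a b"
    and q: "\<And>f m. f \<in> compositions a b \<Longrightarrow> q (cyclic_shift a m f) = q f"
  shows "(\<Sum>f\<in>compositions a b. q f) = real a * (\<Sum>f\<in>dyck a b. q f)"
proof -
  let ?X = "compositions a b" and ?D = "dyck a b"
  have "(\<Sum>f\<in>?X. q f) = (\<Sum>f\<in>?X. \<Sum>m<a. if cyclic_shift a m f \<in> ?D then q f else 0)"
  proof (rule sum.cong[OF refl])
    fix f assume "f \<in> ?X"
    from cycle_lemma[OF this assms(1,2)]
    obtain n where n: "n < a" "cyclic_shift a n f \<in> ?D"
      and uniq: "\<And>m. m < a \<and> cyclic_shift a m f \<in> ?D \<Longrightarrow> m = n" by blast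
    have iff: "cyclic_shift a m f \<in> ?D \<longleftrightarrow> m = n" if "m < a" for m
      using n uniq that by blast
    have "(\<Sum>m<a. if cyclic_shift a m f \<in> ?D then q f else 0) = (\<Sum>m<a. if m = n then q f else 0)"
      by (intro sum.cong refl) (simp add: iff)
    also have "\<dots> = q f" using n(1) by simp
    finally show "q f = (\<Sum>m<a. if cyclic_shift a m f \<in> ?D then q f else 0)" ..
  qed
  also have "\<dots> = (\<Sum>m<a. \<Sum>f\<in>?X. if cyclic_shift a m f \<in> ?D then q (cyclic_shift a m f) else 0)"
    by (subst sum.swap) (simp add: q cong: if_cong)
  also have "\<dots> = (\<Sum>m<a. \<Sum>f\<in>?X. if f \<in> ?D then q f else 0)"
    using sum.reindex_bij_betw[OF bij_betw_cyclic_shift, of "\<lambda>f. if f \<in> ?D then q f else 0"]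
    by simp
  also have "(\<Sum>f\<in>?X. if f \<in> ?D then q f else 0) = (\<Sum>f\<in>?D. q f)"
    by (subst sum.inter_filter[symmetric, OF finite_compositions])
      (rule sum.cong, auto simp: dyck_def)
  finally show ?thesis by simp
qed

lemma spread_cyclic_shift:
  assumes "f \<in> compositions a b" and "0 < a"
  shows "spread a b (cyclic_shift a m f) = spread a b f"
proof -
  let ?h = "\<lambda>k. real_of_int (height a b f k)"
  have "spread a b (cyclic_shift a m f) =
      (\<Sum>k<a. \<Sum>l<a. (?h ((k + m) mod a) - ?h ((l + m) mod a))\<^sup>2)"
    by (simp add: spread_def height_cyclic_shift[OF assms(2)] height_mod_period[OF assms])
  also have "\<dots> = (\<Sum>k<a. \<Sum>l<a. (?h ((k + m) mod a) - ?h l)\<^sup>2)"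
    by (intro sum.cong refl sum_add_mod)
  also have "\<dots> = spread a b f"
    using sum_add_mod[of "\<lambda>k. \<Sum>l<a. (?h k - ?h l)\<^sup>2" m a] by (simp add: spread_def)
  finally show ?thesis .
qed

section \<open>Moments of weak compositions\<close>

text \<open>Given \<open>f i + f j\<close> and all other values, the pair \<open>(f i, f j)\<close> is uniformly distributed.\<close>

lemma sum_compositions_pair_eq_0:
  fixes g :: "nat \<Rightarrow> nat \<Rightarrow> real"
  assumes ij: "i < a" "j < a" "i \<noteq> j" and g: "\<And>s. (\<Sum>p\<le>s. g p (s - p)) = 0"
  shows "(\<Sum>f\<in>compositions a b. g (f i) (f j)) = 0"
proof -
  let ?X = "compositions a b"
  \<comment> \<open>The fibres of \<open>?r\<close> fix \<open>f i + f j\<close> and all other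
    values; each is parametrized by the value \<open>p\<close> at \<open>i\<close>.\<close>
  let ?r = "\<lambda>f :: nat \<Rightarrow> nat. f(i := f i + f j, j := 0)"
  have split: "(\<Sum>k<a. f k) = f i + f j + (\<Sum>k\<in>{..<a} - {i, j}. f k)" for f :: "nat \<Rightarrow> nat"
  proof -
    have "(\<Sum>k<a. f k) = f i + (\<Sum>k\<in>{..<a} - {i}. f k)"
      using ij by (intro sum.remove) auto
    also have "(\<Sum>k\<in>{..<a} - {i}. f k) = f j + (\<Sum>k\<in>{..<a} - {i} - {j}. f k)"
      using ij by (intro sum.remove) auto
    also have "{..<a} - {i} - {j} = {..<a} - {i, j}" by blast
    finally show ?thesis by simp
  qed
  have "(\<Sum>f\<in>?X. g (f i) (f j)) = (\<Sum>y\<in>?r ` ?X. \<Sum>f\<in>{f \<in> ?X. ?r f = y}. g (f i) (f j))"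
    by (rule sum.image_gen[OF finite_compositions])
  also have "\<dots> = (\<Sum>y\<in>?r ` ?X. 0)"
  proof (rule sum.cong[OF refl])
    fix y assume "y \<in> ?r ` ?X"
    then obtain e where e: "e \<in> ?X" "y = ?r e" by blast
    define s where "s = e i + e j"
    let ?c = "\<lambda>p. e(i := p, j := s - p)"
    have "{f \<in> ?X. ?r f = y} = ?c ` {..s}"
    proof
      show "{f \<in> ?X. ?r f = y} \<subseteq> ?c ` {..s}"
      proof
        fix f assume "f \<in> {f \<in> ?X. ?r f = y}"
        then have eq: "?r f = ?r e" using e by simp
        have s: "f i + f j = s" using fun_cong[OF eq, of i] ij by (simp add: s_def)
        have "f = ?c (f i)"
        proof
          fix k
          consider "k = i" | "k = j" | "k \<noteq> i" "k \<noteq> j" by blast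
          then show "f k = ?c (f i) k"
          proof cases
            case 2
            then show ?thesis using s by simp
          next
            case 3
            then show ?thesis using fun_cong[OF eq, of k] by simp
          qed (use ij in simp)
        qed
        moreover have "f i \<in> {..s}" using s by auto
        ultimately show "f \<in> ?c ` {..s}" by (rule image_eqI)
      qed
      show "?c ` {..s} \<subseteq> {f \<in> ?X. ?r f = y}"
      proof (rule image_subsetI)
        fix p assume p: "p \<in> {..s}"
        have "(\<Sum>k<a. ?c p k) = p + (s - p) + (\<Sum>k\<in>{..<a} - {i, j}. e k)"
          using ij by (subst split) (auto intro!: sum.cong)
        also have "\<dots> = (\<Sum>k<a. e k)" using p by (simp add: split[of e] s_def)
        finally have "?c p \<in> ?X" using e(1) ij by (auto simp: compositions_def)
        moreover have "?r (?c p) = y" using e(2) p ij by (auto simp: s_def)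
        ultimately show "?c p \<in> {f \<in> ?X. ?r f = y}" by blast
      qed
    qed
    moreover have "inj_on ?c {..s}"
    proof (rule inj_onI)
      fix p q assume eq: "?c p = ?c q"
      show "p = q" using fun_cong[OF eq, of i] ij by simp
    qed
    ultimately have "(\<Sum>f\<in>{f \<in> ?X. ?r f = y}. g (f i) (f j)) = (\<Sum>p\<le>s. g p (s - p))"
      using ij by (simp add: sum.reindex)
    then show "(\<Sum>f\<in>{f \<in> ?X. ?r f = y}. g (f i) (f j)) = 0" using g by simp
  qed
  finally show ?thesis by simp
qed

lemma sum_atMost_real: "(\<Sum>p\<le>s. real p) = real s * (real s + 1) / 2"
  by (induction s) (auto simp: field_simps)

lemma sum_atMost_real_squares:
  "(\<Sum>p\<le>s. (real p)\<^sup>2) = real s * (real s + 1) * (2 * real s + 1) / 6"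
  by (induction s) (auto simp: field_simps power2_eq_square)

text \<open>All coordinates have the same sum \<open>M i\<close>, and they total \<open>b\<close>,
  which gives the first moment. The second moments \<open>A\<close> and \<open>C j\<close> solve two
  linear equations, one from the uniform distribution of pairs and one from the total.\<close>

lemma moments_compositions:
  fixes a b i :: nat
  assumes "0 < a" and i: "i < a"
  defines "N \<equiv> real (card (compositions a b))"
  shows first_moment_compositions:
      "(\<Sum>f\<in>compositions a b. real (f i)) = real b * N / real a"
    and second_moment_compositions:
      "(\<Sum>f\<in>compositions a b. (real (f i))\<^sup>2) =
        real b * (2 * real b + real a - 1) * N / (real a * (real a + 1))"
    and mixed_moment_compositions:
      "\<And>j. j < a \<Longrightarrow> j \<noteq> i \<Longrightarrow> (\<Sum>f\<in>compositions a b. real (f i) * real (f j)) =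
        real b * (real b - 1) * N / (real a * (real a + 1))"
proof -
  let ?X = "compositions a b"
  define M where "M j = (\<Sum>f\<in>?X. real (f j))" for j
  define A where "A = (\<Sum>f\<in>?X. (real (f i))\<^sup>2)"
  define C where "C j = (\<Sum>f\<in>?X. real (f i) * real (f j))" for j
  have total: "(\<Sum>j<a. real (f j)) = real b" if "f \<in> ?X" for f
    using that by (simp add: compositions_def flip: of_nat_sum)
  have M_eq: "M j = M i" if "j < a" for j
  proof (cases "j = i")
    case False
    have "(\<Sum>p\<le>s. real p - real (s - p)) = 0" for s
    proof -
      have "(\<Sum>p\<le>s. real p - real (s - p)) = (\<Sum>p\<le>s. 2 * real p - real s)"
        by (intro sum.cong) (auto simp: of_nat_diff)
      also have "\<dots> = 0"
        by (simp add: sum_subtractf sum_distrib_left[symmetric] sum_atMost_real)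
      finally show ?thesis .
    qed
    from sum_compositions_pair_eq_0[OF that i False, of "\<lambda>p q. real p - real q" b, OF this]
    show ?thesis by (simp add: M_def sum_subtractf)
  qed simp
  have "real b * N = (\<Sum>f\<in>?X. \<Sum>j<a. real (f j))" by (simp add: total N_def)
  also have "\<dots> = (\<Sum>j<a. M j)" unfolding M_def by (rule sum.swap)
  also have "\<dots> = real a * M i" using M_eq by simp
  finally have M: "M i = real b * N / real a" using assms(1) by (simp add: field_simps)
  \<comment> \<open>The test function is chosen so that \<open>p^2 - p\<close> and
    \<open>2 * p * (s - p)\<close> have equal sums over \<open>p \<le> s\<close>.\<close>
  have C_eq: "C j = (A - M i) / 2" if "j < a" "j \<noteq> i" for j
  proof -
    have "(\<Sum>p\<le>s. (real p)\<^sup>2 - real p - 2 * (real p * real (s - p))) = 0" for s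
    proof -
      have "(\<Sum>p\<le>s. (real p)\<^sup>2 - real p - 2 * (real p * real (s - p))) =
          (\<Sum>p\<le>s. 3 * (real p)\<^sup>2 - (1 + 2 * real s) * real p)"
        by (intro sum.cong) (auto simp: of_nat_diff algebra_simps power2_eq_square)
      also have "\<dots> = 3 * (\<Sum>p\<le>s. (real p)\<^sup>2) - (1 + 2 * real s) * (\<Sum>p\<le>s. real p)"
        by (simp add: sum_subtractf sum_distrib_left)
      also have "\<dots> = 0"
        by (simp add: sum_atMost_real sum_atMost_real_squares field_simps)
      finally show ?thesis .
    qed
    from sum_compositions_pair_eq_0[OF i that(1) that(2)[symmetric],
        of "\<lambda>p q. (real p)\<^sup>2 - real p - 2 * (real p * real q)" b, OF this]
    show ?thesis by (simp add: A_def M_def C_def sum_subtractf sum_distrib_left[symmetric])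
  qed
  \<comment> \<open>The second equation: the constraint that the values total \<open>b\<close>,
    weighted by \<open>f i\<close>.\<close>
  have "real b * M i = (\<Sum>f\<in>?X. real (f i) * (\<Sum>j<a. real (f j)))"
    by (simp add: total M_def sum_distrib_left mult.commute)
  also have "\<dots> = (\<Sum>j<a. C j)"
    unfolding C_def sum_distrib_left by (rule sum.swap)
  also have "\<dots> = C i + (\<Sum>j\<in>{..<a} - {i}. C j)" using i by (simp add: sum.remove)
  also have "(\<Sum>j\<in>{..<a} - {i}. C j) = (\<Sum>j\<in>{..<a} - {i}. (A - M i) / 2)"
    by (intro sum.cong) (auto simp: C_eq)
  also have "C i = A" by (simp add: C_def A_def power2_eq_square)
  finally have "real b * M i = A + (real a - 1) * ((A - M i) / 2)"
    using i assms(1) by (simp add: of_nat_diff)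
  then have A': "A * (real a + 1) = M i * (2 * real b + real a - 1)"
    by (simp add: field_simps)
  have pos: "real a + 1 \<noteq> 0" "real a \<noteq> 0" using assms(1) by auto
  have "A = M i * (2 * real b + real a - 1) / (real a + 1)"
    using A' pos by (simp add: eq_divide_eq)
  then have A: "A = real b * (2 * real b + real a - 1) * N / (real a * (real a + 1))"
    unfolding M by simp
  show "(\<Sum>f\<in>?X. real (f i)) = real b * N / real a" using M by (simp add: M_def)
  show "(\<Sum>f\<in>?X. (real (f i))\<^sup>2) = real b * (2 * real b + real a - 1) * N / (real a * (real a + 1))"
    using A by (simp add: A_def)
  fix j assume "j < a" "j \<noteq> i"
  then have "C j = (A - M i) / 2" by (rule C_eq)
  also have "\<dots> = real b * (real b - 1) * N / (real a * (real a + 1))"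
    unfolding A M using pos by (simp add: divide_simps) (simp add: algebra_simps)
  finally show "(\<Sum>f\<in>?X. real (f i) * real (f j)) = real b * (real b - 1) * N / (real a * (real a + 1))"
    by (simp add: C_def)
qed

text \<open>The steps \<open>b - a * f i\<close> of the height have mean 0, are exchangeable and add
  up to 0 over a period. This forces their covariance matrix to be a multiple of \<open>a\<close>
  times the identity minus the all-ones matrix; the moments supply the factor.\<close>

lemma covariance_compositions:
  assumes "0 < a" and "i < a" and "j < a"
  shows "(\<Sum>f\<in>compositions a b. (real b - real a * real (f i)) * (real b - real a * real (f j))) =
    real b * (real a + real b) / (real a + 1) * real (card (compositions a b)) *
      ((if i = j then real a else 0) - 1)"
proof -
  let ?X = "compositions a b" and ?N = "real (card (compositions a b))"
  have pos: "real a + 1 \<noteq> 0" "real a \<noteq> 0" using assms(1) by auto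
  have "(\<Sum>f\<in>?X. (real b - real a * real (f i)) * (real b - real a * real (f j))) =
    (real b)\<^sup>2 * ?N - real a * real b * (\<Sum>f\<in>?X. real (f i)) - real a * real b * (\<Sum>f\<in>?X. real (f j))
     + (real a)\<^sup>2 * (\<Sum>f\<in>?X. real (f i) * real (f j))"
    by (simp add: algebra_simps sum.distrib sum_subtractf sum_distrib_left power2_eq_square)
  also have "\<dots> = real b * (real a + real b) / (real a + 1) * ?N * ((if i = j then real a else 0) - 1)"
  proof (cases "i = j")
    case True
    then show ?thesis
      using pos
      by (simp add: first_moment_compositions[OF assms(1,3)]
          second_moment_compositions[OF assms(1,3)] flip: power2_eq_square)
        (simp add: divide_simps, simp add: algebra_simps power2_eq_square)
  next
    case False
    then show ?thesis
      using pos assms(1)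
      by (simp add: first_moment_compositions[OF assms(1)] assms(2,3)
          mixed_moment_compositions[OF assms(1,2,3)])
        (simp add: divide_simps, simp add: algebra_simps power2_eq_square)
  qed
  finally show ?thesis .
qed

lemma height_diff:
  assumes "l \<le> k" and "k \<le> a"
  shows "real_of_int (height a b f k) - real_of_int (height a b f l) =
    (\<Sum>j\<in>{l..<k}. real b - real a * real (f j))"
  using assms
proof (induction k rule: dec_induct)
  case (step k)
  then show ?case by (simp add: height_Suc)
qed simp

text \<open>The difference is a sum of m = |k - l| steps. In its expanded square the m diagonal
  terms contribute \<open>a\<close> each and all m^2 terms contribute -1, giving a * m - m^2 as for
  a random bridge.\<close>

lemma sum_compositions_height_diff:
  assumes "0 < a" and "k \<le> a" and "l \<le> a"
  shows "(\<Sum>f\<in>compositions a b. (real_of_int (height a b f k) - real_of_int (height a b f l))\<^sup>2) =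
    real b * (real a + real b) / (real a + 1) * real (card (compositions a b)) *
      (real a * \<bar>real k - real l\<bar> - (real k - real l)\<^sup>2)"
proof -
  have le: "(\<Sum>f\<in>compositions a b. (real_of_int (height a b f k) - real_of_int (height a b f l))\<^sup>2) =
    real b * (real a + real b) / (real a + 1) * real (card (compositions a b)) *
      (real a * \<bar>real k - real l\<bar> - (real k - real l)\<^sup>2)" if "l \<le> k" "k \<le> a" for k l
  proof -
    let ?y = "\<lambda>f j. real b - real a * real (f j)"
    let ?K = "real b * (real a + real b) / (real a + 1) * real (card (compositions a b))"
    have "(\<Sum>f\<in>compositions a b. (real_of_int (height a b f k) - real_of_int (height a b f l))\<^sup>2) =
        (\<Sum>f\<in>compositions a b. \<Sum>i\<in>{l..<k}. \<Sum>j\<in>{l..<k}. ?y f i * ?y f j)"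
      by (simp add: height_diff[OF that] power2_eq_square sum_product)
    also have "\<dots> = (\<Sum>i\<in>{l..<k}. \<Sum>j\<in>{l..<k}. \<Sum>f\<in>compositions a b. ?y f i * ?y f j)"
      by (subst sum.swap) (intro sum.cong refl sum.swap)
    also have "\<dots> = (\<Sum>i\<in>{l..<k}. \<Sum>j\<in>{l..<k}. ?K * ((if i = j then real a else 0) - 1))"
      using that by (intro sum.cong refl covariance_compositions[OF assms(1)]) auto
    also have "\<dots> = ?K * (\<Sum>i\<in>{l..<k}. real a - real (k - l))"
      unfolding sum_distrib_left[symmetric] by (simp add: sum_subtractf)
    also have "\<dots> = ?K * (real a * \<bar>real k - real l\<bar> - (real k - real l)\<^sup>2)"
      using that by (simp add: of_nat_diff algebra_simps power2_eq_square)
    finally show ?thesis .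
  qed
  show ?thesis
  proof (cases "l \<le> k")
    case True
    then show ?thesis using le assms by blast
  next
    case False
    then show ?thesis using le[of k l] assms by (simp add: power2_commute abs_minus_commute)
  qed
qed

lemma sum_abs_differences:
  "(\<Sum>k<n. \<Sum>l<n. \<bar>real k - real l\<bar>) = real n * ((real n)\<^sup>2 - 1) / 3"
proof (induction n)
  case (Suc n)
  have eq: "(\<Sum>l<n. \<bar>real n - real l\<bar>) = real n * (real n + 1) / 2"
  proof -
    have "(\<Sum>l<n. \<bar>real n - real l\<bar>) = (\<Sum>l<n. real n - real l)" by (intro sum.cong) auto
    then show ?thesis by (simp add: sum_subtractf sum_real_lessThan field_simps)
  qed
  moreover have "(\<Sum>k<n. \<bar>real k - real n\<bar>) = real n * (real n + 1) / 2"
    using eq by (simp add: abs_minus_commute)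
  ultimately show ?case
    using Suc by (simp add: sum.distrib) (simp add: field_simps power2_eq_square)
qed simp

lemma sum_compositions_spread:
  assumes "0 < a"
  shows "(\<Sum>f\<in>compositions a b. spread a b f) =
    real b * (real a + real b) * (real a - 1) * (real a)\<^sup>2 / 6 * real (card (compositions a b))"
proof -
  let ?K = "real b * (real a + real b) / (real a + 1) * real (card (compositions a b))"
  have "(\<Sum>f\<in>compositions a b. spread a b f) = (\<Sum>k<a. \<Sum>l<a. \<Sum>f\<in>compositions a b.
      (real_of_int (height a b f k) - real_of_int (height a b f l))\<^sup>2)"
    unfolding spread_def by (subst sum.swap) (intro sum.cong refl sum.swap)
  also have "\<dots> = (\<Sum>k<a. \<Sum>l<a. ?K * (real a * \<bar>real k - real l\<bar> - (real k - real l)\<^sup>2))"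
    by (intro sum.cong refl sum_compositions_height_diff[OF assms]) auto
  also have "\<dots> = ?K * (real a * (\<Sum>k<a. \<Sum>l<a. \<bar>real k - real l\<bar>)
      - (\<Sum>k<a. \<Sum>l<a. (real k - real l)\<^sup>2))"
    by (simp only: sum_distrib_left[symmetric] sum_subtractf)
  also have "\<dots> = ?K * ((real a)\<^sup>2 * ((real a)\<^sup>2 - 1) / 6)"
    unfolding sum_abs_differences sum_squared_differences sum_real_lessThan sum_real_squares_lessThan
    by (simp add: field_simps power2_eq_square)
  \<comment> \<open>The factor \<open>a + 1\<close> is split off to cancel the denominator of
    \<open>?K\<close>.\<close>
  also have "(real a)\<^sup>2 * ((real a)\<^sup>2 - 1) / 6 = (real a + 1) * ((real a - 1) * (real a)\<^sup>2 / 6)"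
    by (simp add: field_simps power2_eq_square)
  also have "?K * \<dots> = real b * (real a + real b) * (real a - 1) * (real a)\<^sup>2 / 6 * real (card (compositions a b))"
  proof -
    have "real a + 1 \<noteq> 0" by linarith
    then show ?thesis by (simp add: divide_simps)
  qed
  finally show ?thesis .
qed

section \<open>The average size\<close>

text \<open>Passing from compositions to Dyck paths divides both the total spread and the count by
  \<open>a\<close>, so the average spread is unchanged.\<close>

theorem average_core_size_eq:
  assumes "0 < a" and "0 < b" and "coprime a b"
  shows "average_core_size a b = (real a - 1) * (real b - 1) * (real a + real b + 1) / 24"
proof -
  let ?N = "real (card (compositions a b))" and ?n = "real (card (dyck a b))"
  have N: "?N = real a * ?n"
    using sum_compositions_eq_sum_dyck[OF assms(1,3), of "\<lambda>_. 1"] by simp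
  then have n: "?n \<noteq> 0"
    using card_compositions_pos[OF assms(1), of b] by (metis mult_zero_right of_nat_0_less_iff less_irrefl)
  have "real a * (\<Sum>f\<in>dyck a b. spread a b f) = (\<Sum>f\<in>compositions a b. spread a b f)"
    using sum_compositions_eq_sum_dyck[OF assms(1,3), of "spread a b"] spread_cyclic_shift assms(1)
    by simp
  also have "\<dots> = real a * (real b * (real a + real b) * (real a - 1) * (real a)\<^sup>2 / 6 * ?n)"
    unfolding sum_compositions_spread[OF assms(1)] N by simp
  finally have spread: "(\<Sum>f\<in>dyck a b. spread a b f) =
      real b * (real a + real b) * (real a - 1) * (real a)\<^sup>2 / 6 * ?n"
    using assms(1) by simp
  have "average_core_size a b =
      ((\<Sum>f\<in>dyck a b. spread a b f) / (4 * (real a)\<^sup>2) - ?n * (((real a)\<^sup>2 - 1) / 24)) / ?n"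
    unfolding average_core_size_dyck[OF assms] by (simp add: sum_subtractf sum_divide_distrib)
  also have "\<dots> = real b * (real a + real b) * (real a - 1) / 24 - ((real a)\<^sup>2 - 1) / 24"
    unfolding spread using n assms(1) by (simp add: diff_divide_distrib)
  \<comment> \<open>After taking out \<open>a - 1\<close>, this is
    \<open>b * (a + b) - (a + 1) = (b - 1) * (a + b + 1)\<close>.\<close>
  also have "\<dots> = (real a - 1) * (real b - 1) * (real a + real b + 1) / 24"
    by (simp add: field_simps power2_eq_square)
  finally show ?thesis .
qed

theorem mainTheorem4:
  fixes a :: nat
  assumes "a \<ge> 2"
  shows "\<exists>P :: real poly. degree P = 2 \<and>
           (\<forall>b :: nat. 0 < b \<and> coprime a b \<longrightarrow> average_core_size a b = poly P (real b))"
proof -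
  \<comment> \<open>Armstrong's formula read as a polynomial in \<open>b\<close>; its leading
    coefficient \<open>(a - 1) / 24\<close> is nonzero because \<open>a \<ge> 2\<close>.\<close>
  define P :: "real poly" where
    "P = smult ((real a - 1) / 24) ([:-1, 1:] * [:real a + 1, 1:])"
  have "degree P = 2"
    using assms by (simp add: P_def)
  moreover have "average_core_size a b = poly P (real b)" if "0 < b" "coprime a b" for b
  proof -
    have "poly P (real b) = (real a - 1) * (real b - 1) * (real a + real b + 1) / 24"
      by (simp add: P_def field_simps)
    then show ?thesis using average_core_size_eq[of a b] that assms by simp
  qed
  ultimately show ?thesis by blast
qed

end
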